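(* Let $n$ be a positive integer or $n=\infty$, and let $T=(T_1,\ldots,T_n)$ be an $n$-tuple of non-zero bounded operators on a Hilbert space $\mathcal H$ with $\sum_{i=1}^nT_iT_i^*\le I_{\mathcal H}$. Let $\mathcal P=\{P_k\}_{k\in\mathcal J}$ be a countable family of projections which stabilizes $T$ and such that for every $k$ there is some $i$ with $T_iP_k\ne0$, let $G$ be the associated directed graph, and write $T=(T_e)_{e\in E(G)}$. Then every minimal partially isometric dilation of $T=(T_e)_{e\in E(G)}$ is pure if and only if $$\lim_{d\to\infty}\Bigl(\sum_{w\in\mathbb F^+(G);\,|w|=d}\|w(T)^*\xi\|^2\Bigr)=0\quad\text{for all }\xi\in\mathcal H.$$
   Context: Projections are orthogonal projections; infinite sums of operators are in the strong operator topology; $\vee$ denotes closed linear span. Stabilizing family: a countable family $\mathcal P=\{P_k:k\in\mathcal J\}$ of projections on $\mathcal H$ stabilizes $T$ if $P_kT_i\in\{T_i,0\}$ and $T_iP_k\in\{T_i,0\}$ for all $k$ and $i$, and $\sum_{k\in\mathcal J}P_k=I_{\mathcal H}$. For each $i$ let $s(T_i),r(T_i)\in\mathcal J$ be the indices with $T_iP_{s(T_i)}=T_i$ and $P_{r(T_i)}T_i=T_i$. The associated directed graph $G$ has vertex set $V(G)=\mathcal J$ and one edge for each $i$, from $s(T_i)$ to $r(T_i)$; re-indexing by edges gives $T=(T_e)_{e\in E(G)}$. Relations $(\dagger)$: an $n$-tuple $S=(S_1,\ldots,S_n)$ of non-zero operators on a Hilbert space $\mathcal K$ satisfies $(\dagger)$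 if (1) $(S_i^*S_i)^2=S_i^*S_i$ for all $i$; (2) $\sum_iS_iS_i^*\le I$; (3) for all $i,j$, either $(S_i^*S_i)(S_j^*S_j)=0$ or $S_i^*S_i=S_j^*S_j$; (4) for every $i$ there is $j$ with $S_iS_i^*\le S_j^*S_j$; (5) if $\{Q_k\}$ are the distinct elements of $\{S_i^*S_i\}$, then $\sum_kQ_k=I$. Such $S$ has a directed graph: its vertices index the $Q_k$, and each $S_i$ gives an edge from $k$ to $l$ where $S_i^*S_i=Q_k$ and $S_iS_i^*\le Q_l$; one writes $S=(S_e)_{e\in E(G)}$ for this graph $G$. Minimal partially isometric dilation of $T$: an $n$-tuple $S$ on $\mathcal K\supseteq\mathcal H$ such that (i) $S$ satisfies $(\dagger)$; (ii) $\mathcal H$ reduces each $S_i^*S_i$, and is invariant for each $S_i^*$ with $S_i^*|_{\mathcal H}=T_i^*$; (iii) $\mathcal K=\mathcal H\vee\bigl(\bigvee_{i_1,\ldots,i_k;\,k\ge1}S_{i_1}\cdots S_{i_k}\mathcal H\bigr)$. Paths: for a directed graph $G$, $\mathbb F^+(G)$ is the set of all vertices and all finite paths in the edges of $G$; a path $w=e_{1}e_{2}\cdots e_{m}$ is written right to left, i.e. the initial vertex of $e_{j}$ is the final vertex of $e_{j+1}$; $|w|=m$ is its number of edges (vertices have length $0$); and for such a $w$ with $m\ge1$, $w(S)=S_{e_1}\cdots S_{e_m}$, $w(T)=T_{e_1}\cdots T_{e_m}$. Pure: $S=(S_e)_{e\in E(G)}$ on $\mathcal K$ satisfying $(\dagger)$,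 with $G$ its own directed graph, is pure if $\lim_{d\to\infty}\sum_{w\in\mathbb F^+(G);\,|w|=d}\|w(S)^*\xi\|^2=0$ for all $\xi\in\mathcal K$. *)

theory Defs
  imports "HOL-Analysis.Analysis" "HOL-Library.Extended_Nat" "Graph_Theory.Digraph"
begin

section \<open>Complex Hilbert spaces\<close>

text \<open>
  The distribution only has real inner product spaces.  A complex Hilbert space is a complete real
  inner product space with a compatible complex scalar multiplication and a sesquilinear form
  (linear in the first argument) whose real part is the real inner product; norm, topology and
  completeness are those of the library classes.
\<close>

class complex_inner = real_inner +
  fixes scaleC :: "complex \<Rightarrow> 'a \<Rightarrow> 'a"  (infixr \<open>*\<^sub>C\<close> 75)
    and cinner :: "'a \<Rightarrow> 'a \<Rightarrow> complex"
  assumes scaleC_add_right: "c *\<^sub>C (x + y) = c *\<^sub>C x + c *\<^sub>C y"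
    and scaleC_add_left: "(c + d) *\<^sub>C x = c *\<^sub>C x + d *\<^sub>C x"
    and scaleC_scaleC: "c *\<^sub>C d *\<^sub>C x = (c * d) *\<^sub>C x"
    and scaleC_of_real: "complex_of_real r *\<^sub>C x = r *\<^sub>R x"
    and cinner_commute: "cinner x y = cnj (cinner y x)"
    and cinner_add_left: "cinner (x + y) z = cinner x z + cinner y z"
    and cinner_scaleC_left: "cinner (c *\<^sub>C x) y = c * cinner x y"
    and Re_cinner: "Re (cinner x y) = inner x y"

class chilbert_space = complex_inner + complete_space

lemma vector_space_scaleC: "vector_space (scaleC :: complex \<Rightarrow> 'a::complex_inner \<Rightarrow> 'a)"
proof
  show "1 *\<^sub>C x = x" for x :: 'a
    using scaleC_of_real[of 1 x] by simp
qed (simp_all add: scaleC_add_right scaleC_add_left scaleC_scaleC)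

instantiation complex :: chilbert_space
begin

definition scaleC_complex :: "complex \<Rightarrow> complex \<Rightarrow> complex" where
  "scaleC_complex c x = c * x"

definition cinner_complex :: "complex \<Rightarrow> complex \<Rightarrow> complex" where
  "cinner_complex x y = x * cnj y"

instance
  by standard
    (auto simp: scaleC_complex_def cinner_complex_def algebra_simps inner_complex_def
      scaleR_conv_of_real)

end

definition cspan :: "'a::complex_inner set \<Rightarrow> 'a set" where
  "cspan X = module.span scaleC X"

definition clinear :: "('a::complex_inner \<Rightarrow> 'b::complex_inner) \<Rightarrow> bool" where
  "clinear f \<longleftrightarrow> (\<forall>x y. f (x + y) = f x + f y) \<and> (\<forall>c x. f (c *\<^sub>C x) = c *\<^sub>C f x)"

definition bounded_clinear :: "('a::complex_inner \<Rightarrow> 'b::complex_inner) \<Rightarrow> bool" where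
  "bounded_clinear f \<longleftrightarrow> clinear f \<and> (\<exists>B. \<forall>x. norm (f x) \<le> B * norm x)"

section \<open>Operators\<close>

text \<open>
  The adjoint is only used for bounded operators on a Hilbert space, where it exists and is unique
  (compare the constant \<^const>\<open>adjoint\<close> for real inner products).
\<close>

definition cadjoint :: "('a::complex_inner \<Rightarrow> 'b::complex_inner) \<Rightarrow> 'b \<Rightarrow> 'a" where
  "cadjoint f = (SOME g. \<forall>x y. cinner (f x) y = cinner x (g y))"

definition zero_op :: "'a::complex_inner \<Rightarrow> 'b::complex_inner" where
  "zero_op = (\<lambda>x. 0)"

definition is_projection :: "('a::complex_inner \<Rightarrow> 'a) \<Rightarrow> bool" where
  "is_projection P \<longleftrightarrow> bounded_clinear P \<and> P \<circ> P = P \<and> cadjoint P = P"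

definition op_le :: "('a::complex_inner \<Rightarrow> 'a) \<Rightarrow> ('a \<Rightarrow> 'a) \<Rightarrow> bool" where
  "op_le A B \<longleftrightarrow>
    (\<forall>x. Im (cinner (B x - A x) x) = 0 \<and> Re (cinner (B x - A x) x) \<ge> 0)"

definition sot_has_sum :: "('i \<Rightarrow> 'a::complex_inner \<Rightarrow> 'a) \<Rightarrow> 'i set \<Rightarrow> ('a \<Rightarrow> 'a) \<Rightarrow> bool" where
  "sot_has_sum A I B \<longleftrightarrow> (\<forall>x. ((\<lambda>i. A i x) has_sum B x) I)"

definition reduces :: "'a::complex_inner set \<Rightarrow> ('a \<Rightarrow> 'a) \<Rightarrow> bool" where
  "reduces M A \<longleftrightarrow> (let M_perp = {y. \<forall>x\<in>M. cinner x y = 0}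
     in A ` M \<subseteq> M \<and> A ` M_perp \<subseteq> M_perp)"

section \<open>Tuples of operators\<close>

text \<open>
  An \<open>n\<close>-tuple, with \<open>n\<close> possibly infinite, is a function on \<^typ>\<open>nat\<close> of which only the values at
  the \<open>n\<close> indices \<open>0, 1, \<dots>\<close> below \<open>n\<close> matter.
\<close>

definition idx :: "enat \<Rightarrow> nat set" where
  "idx n = {i. enat i < n}"

definition nonzero_operators :: "enat \<Rightarrow> (nat \<Rightarrow> 'a::complex_inner \<Rightarrow> 'a) \<Rightarrow> bool" where
  "nonzero_operators n T \<longleftrightarrow> (\<forall>i\<in>idx n. bounded_clinear (T i) \<and> T i \<noteq> zero_op)"

definition row_contraction :: "enat \<Rightarrow> (nat \<Rightarrow> 'a::complex_inner \<Rightarrow> 'a) \<Rightarrow> bool" where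
  "row_contraction n T \<longleftrightarrow>
    (\<exists>B. sot_has_sum (\<lambda>i. T i \<circ> cadjoint (T i)) (idx n) B \<and> op_le B id)"

definition word_op :: "('e \<Rightarrow> 'a \<Rightarrow> 'a) \<Rightarrow> 'e list \<Rightarrow> 'a \<Rightarrow> 'a" where
  "word_op A w = foldr (\<lambda>e B. A e \<circ> B) w id"

text \<open>
  The paths with \<open>d\<close> edges, written right to left: each edge starts where the next one in the list
  ends.  For \<open>d = 0\<close> this is only the empty list instead of the vertices; below, only the limit
  \<open>d \<rightarrow> \<infinity>\<close> matters.
\<close>

definition paths :: "('v, 'e) pre_digraph \<Rightarrow> nat \<Rightarrow> 'e list set" where
  "paths G d = {w. length w = d \<and> set w \<subseteq> arcs G \<and>
     (\<forall>j. Suc j < length w \<longrightarrow> tail G (w ! j) = head G (w ! Suc j))}"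

section \<open>Stabilizing families\<close>

definition stabilizes ::
    "'j set \<Rightarrow> ('j \<Rightarrow> 'a::complex_inner \<Rightarrow> 'a) \<Rightarrow> enat \<Rightarrow> (nat \<Rightarrow> 'a \<Rightarrow> 'a) \<Rightarrow> bool" where
  "stabilizes J P n T \<longleftrightarrow>
     countable J \<and> (\<forall>k\<in>J. is_projection (P k)) \<and>
     (\<forall>k\<in>J. \<forall>i\<in>idx n. P k \<circ> T i \<in> {T i, zero_op} \<and> T i \<circ> P k \<in> {T i, zero_op}) \<and>
     sot_has_sum P J id"

definition stabilizing_graph ::
    "'j set \<Rightarrow> ('j \<Rightarrow> 'a::complex_inner \<Rightarrow> 'a) \<Rightarrow> enat \<Rightarrow> (nat \<Rightarrow> 'a \<Rightarrow> 'a) \<Rightarrow> ('j, nat) pre_digraph" where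
  "stabilizing_graph J P n T =
     \<lparr> verts = J, arcs = idx n,
       tail = (\<lambda>i. THE k. k \<in> J \<and> T i \<circ> P k = T i),
       head = (\<lambda>i. THE k. k \<in> J \<and> P k \<circ> T i = T i) \<rparr>"

section \<open>The relations \<open>(\<dagger>)\<close> and minimal partially isometric dilations\<close>

definition initial_op :: "(nat \<Rightarrow> 'a::complex_inner \<Rightarrow> 'a) \<Rightarrow> nat \<Rightarrow> 'a \<Rightarrow> 'a" where
  "initial_op S i = cadjoint (S i) \<circ> S i"

definition dagger :: "enat \<Rightarrow> (nat \<Rightarrow> 'a::complex_inner \<Rightarrow> 'a) \<Rightarrow> bool" where
  "dagger n S \<longleftrightarrow>
     nonzero_operators n S \<and>
     (\<forall>i\<in>idx n. initial_op S i \<circ> initial_op S i = initial_op S i) \<and>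
     row_contraction n S \<and>
     (\<forall>i\<in>idx n. \<forall>j\<in>idx n.
        initial_op S i \<circ> initial_op S j = zero_op \<or> initial_op S i = initial_op S j) \<and>
     (\<forall>i\<in>idx n. \<exists>j\<in>idx n. op_le (S i \<circ> cadjoint (S i)) (initial_op S j)) \<and>
     sot_has_sum (\<lambda>Q. Q) (initial_op S ` idx n) id"

text \<open>The vertices are the distinct operators \<open>Q\<^sub>k\<close> themselves.\<close>

definition dagger_graph ::
    "enat \<Rightarrow> (nat \<Rightarrow> 'a::complex_inner \<Rightarrow> 'a) \<Rightarrow> ('a \<Rightarrow> 'a, nat) pre_digraph" where
  "dagger_graph n S =
     \<lparr> verts = initial_op S ` idx n, arcs = idx n,
       tail = initial_op S,
       head = (\<lambda>i. THE Q. Q \<in> initial_op S ` idx n \<and> op_le (S i \<circ> cadjoint (S i)) Q) \<rparr>"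

text \<open>
  The containing space is a type \<open>'k\<close>, and the inclusion of the original space is a linear isometry
  \<open>V\<close>.
\<close>

definition minimal_pi_dilation ::
    "enat \<Rightarrow> (nat \<Rightarrow> 'h::complex_inner \<Rightarrow> 'h) \<Rightarrow> ('h \<Rightarrow> 'k::complex_inner) \<Rightarrow>
     (nat \<Rightarrow> 'k \<Rightarrow> 'k) \<Rightarrow> bool" where
  "minimal_pi_dilation n T V S \<longleftrightarrow>
     clinear V \<and> (\<forall>h. norm (V h) = norm h) \<and>
     dagger n S \<and>
     (\<forall>i\<in>idx n. reduces (range V) (initial_op S i)) \<and>
     (\<forall>i\<in>idx n. \<forall>h. cadjoint (S i) (V h) = V (cadjoint (T i) h)) \<and>
     closure (cspan (range V \<union>
       (\<Union>w\<in>{w. w \<noteq> [] \<and> set w \<subseteq> idx n}. word_op S w ` range V))) = UNIV"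

text \<open>
  Under the row contraction condition the sums over the paths of length \<open>d\<close> are bounded by
  \<open>(norm \<xi>)\<^sup>2\<close>, so they always converge, also when there are infinitely many edges.
\<close>

definition pure :: "enat \<Rightarrow> (nat \<Rightarrow> 'k::complex_inner \<Rightarrow> 'k) \<Rightarrow> bool" where
  "pure n S \<longleftrightarrow>
     (\<forall>\<xi>. (\<lambda>d. \<Sum>\<^sub>\<infinity>w\<in>paths (dagger_graph n S) d. (norm (cadjoint (word_op S w) \<xi>))\<^sup>2)
            \<longlonglongrightarrow> 0)"

end

theory Submission
  imports Defs
begin

text \<open>
  A dilation \<open>S\<close> of \<open>T\<close> satisfies \<open>S\<^sub>i\<^sup>* V = V T\<^sub>i\<^sup>*\<close>, hence \<open>w(S)\<^sup>* V = V w(T)\<^sup>*\<close> for every word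
  \<open>w\<close>. Words that are not paths contribute nothing: at a broken joint the operators \<open>T\<^sub>a T\<^sub>b\<close> and
  \<open>S\<^sub>a S\<^sub>b\<close> vanish, because distinct vertices carry orthogonal projections. Thus both
  sums over paths are the sum over all words of length \<open>d\<close>, called \<open>energy\<close> below, and the graphs
  of \<open>T\<close> and \<open>S\<close> need not be compared. As \<open>V\<close> is isometric, the energies of \<open>\<xi>\<close> under \<open>T\<close> and
  of \<open>V \<xi>\<close> under \<open>S\<close> coincide, so purity of \<open>S\<close> implies the limit condition on \<open>T\<close>.

  For the converse, consider the set of vectors whose energy under \<open>S\<close> tends to \<open>0\<close>. Since
  \<open>\<Sum>\<^sub>i S\<^sub>i S\<^sub>i\<^sup>* \<le> I\<close>, the energy is at most the squared norm, and this set is a closed complex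
  subspace (\<open>vanishing_subspace\<close>, \<open>vanishing_closed\<close>). It is invariant under each \<open>S\<^sub>i\<close>: the
  ranges of the \<open>S\<^sub>j\<close> are orthogonal, so of the adjoints only \<open>S\<^sub>i\<^sup>*\<close> sees \<open>S\<^sub>i \<eta>\<close>, and it
  turns it into \<open>Q \<eta>\<close> with \<open>Q = S\<^sub>i\<^sup>* S\<^sub>i\<close>; every further \<open>S\<^sub>e\<^sup>*\<close> either absorbs or kills \<open>Q\<close>. So
  \<open>S\<^sub>i\<close> only delays the decay by one step (\<open>vanishing_invariant\<close>). Under the limit condition the
  set contains the range of \<open>V\<close>, and by minimality it is the whole space.
\<close>

section \<open>Adjoints\<close>

text \<open>
  The representing vector is the minimizer of \<open>x \<mapsto> \<parallel>x\<parallel>\<^sup>2 - 2 f x\<close>: the parallelogram law makes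
  minimizing sequences Cauchy, and the first variation at the minimum is the claim.
\<close>

lemma riesz_representation:
  fixes f :: "'a::{real_inner,complete_space} \<Rightarrow> real"
  assumes "bounded_linear f"
  shows "\<exists>z. \<forall>x. f x = inner x z"
proof -
  interpret f: bounded_linear f by fact
  define g where "g x = (norm x)\<^sup>2 - 2 * f x" for x
  obtain K where K: "\<And>x. \<bar>f x\<bar> \<le> norm x * K"
    using f.bounded by auto
  have low: "g x \<ge> - K\<^sup>2" for x
  proof -
    have "0 \<le> (norm x - K)\<^sup>2" by simp
    then show ?thesis using K[of x] by (simp add: g_def power2_eq_square algebra_simps)
  qed
  define m where "m = Inf (range g)"
  have bdd: "bdd_below (range g)" using low by (auto simp: bdd_below_def)
  have m_le: "m \<le> g x" for x unfolding m_def using bdd by (simp add: cInf_lower)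
  have "\<exists>x. g x < m + 1 / Suc k" for k
    using cInf_lessD[of "range g" "m + 1 / Suc k"] by (auto simp: m_def)
  then obtain X where X: "\<And>k. g (X k) < m + 1 / Suc k" by metis
  have par: "(norm (a - b))\<^sup>2 \<le> 2 * g a + 2 * g b - 4 * m" for a b
  proof -
    define mid where "mid = (1/2) *\<^sub>R (a + b)"
    have "(norm (a - b))\<^sup>2 + 4 * g mid = 2 * g a + 2 * g b"
      by (simp add: g_def mid_def f.scaleR f.add f.diff power2_norm_eq_inner inner_simps inner_commute
          algebra_simps)
    then show ?thesis using m_le[of mid] by linarith
  qed
  have "Cauchy X"
  proof (rule CauchyI)
    fix e :: real assume e: "e > 0"
    obtain N where N: "1 / real (Suc N) < e\<^sup>2 / 4"
      using nat_approx_posE[of "e\<^sup>2 / 4"] e by auto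
    have "norm (X i - X j) < e" if "i \<ge> N" "j \<ge> N" for i j
    proof -
      have "1 / real (Suc i) \<le> 1 / Suc N" "1 / real (Suc j) \<le> 1 / Suc N"
        using that by (auto simp: field_simps)
      then have "(norm (X i - X j))\<^sup>2 < e\<^sup>2"
        using par[of "X i" "X j"] X[of i] X[of j] N by linarith
      then show ?thesis using e by (simp add: power_less_imp_less_base)
    qed
    then show "\<exists>N. \<forall>i\<ge>N. \<forall>j\<ge>N. norm (X i - X j) < e" by blast
  qed
  then obtain z where z: "X \<longlonglongrightarrow> z"
    using Cauchy_convergent convergent_def by blast
  have "(\<lambda>k. g (X k)) \<longlonglongrightarrow> g z"
    unfolding g_def by (intro tendsto_intros f.tendsto z)
  moreover have "(\<lambda>k. m + 1 / real (Suc k)) \<longlonglongrightarrow> m + 0"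
    by (intro tendsto_intros LIMSEQ_Suc lim_1_over_n)
  ultimately have gz: "g z \<le> m"
    using X by (intro LIMSEQ_le[where X = "\<lambda>k. g (X k)"]) (auto intro: less_imp_le)
  have "f x = inner x z" for x
  proof -
    define c where "c = inner x z - f x"
    define a where "a = (norm x)\<^sup>2 + 1"
    have a: "a > 0" by (simp add: a_def add_nonneg_pos)
    have var: "g (z + t *\<^sub>R x) = g z + t\<^sup>2 * (norm x)\<^sup>2 + 2 * t * c" for t
      unfolding g_def c_def f.scaleR f.add power2_norm_eq_inner
      by (simp add: inner_add_left inner_add_right power2_eq_square algebra_simps inner_commute)
    \<comment> \<open>Adding \<open>1\<close> to the squared norm makes the step size meaningful for \<open>x = 0\<close> too.\<close>
    have "0 \<le> (- c / a)\<^sup>2 * (norm x)\<^sup>2 + 2 * (- c / a) * c"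
      using var[of "- c / a"] m_le[of "z + (- c / a) *\<^sub>R x"] gz by linarith
    also have "\<dots> = - (c / a)\<^sup>2 * (a + 1)"
      using a by (simp add: a_def[symmetric] field_simps power2_eq_square)
        (simp add: a_def field_simps power2_eq_square)
    finally have "(c / a)\<^sup>2 * (a + 1) \<le> 0" by simp
    then have "c = 0" using a by (simp add: mult_le_0_iff)
    then show ?thesis by (simp add: c_def)
  qed
  then show ?thesis by blast
qed

lemma inner_ext: "(\<And>z. inner z x = inner z y) \<Longrightarrow> x = y"
  using vector_eq_ldot[of x y] by blast

lemma cinner_scaleC_right: "cinner x (c *\<^sub>C y) = cnj c * cinner x y"
  by (metis cinner_commute cinner_scaleC_left complex_cnj_mult)

lemma norm_scaleC: "norm (c *\<^sub>C x) = cmod c * norm x"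
proof -
  have "(norm (c *\<^sub>C x))\<^sup>2 = Re ((c * cnj c) * cinner x x)"
    by (simp only: power2_norm_eq_inner Re_cinner[symmetric] cinner_scaleC_left
        cinner_scaleC_right mult.assoc mult.left_commute)
  also have "\<dots> = (cmod c * norm x)\<^sup>2"
    by (simp only: complex_norm_square[symmetric])
      (simp add: Re_cinner power2_norm_eq_inner power_mult_distrib)
  finally show ?thesis by simp
qed

lemma clinear_zero: "clinear f \<Longrightarrow> f 0 = 0"
  unfolding clinear_def by (metis add_cancel_right_right)

lemma clinear_diff:
  assumes "clinear f" shows "f (x - y) = f x - f y"
proof -
  have "f (x - y) + f y = f x"
    using assms unfolding clinear_def by (metis diff_add_cancel)
  then show ?thesis by (simp add: algebra_simps)
qed

lemma bounded_clinear_clinear: "bounded_clinear f \<Longrightarrow> clinear f"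
  by (simp add: bounded_clinear_def)

lemma bounded_clinear_bounded_linear:
  assumes "bounded_clinear f" shows "bounded_linear f"
proof -
  from assms obtain B where B: "\<And>x. norm (f x) \<le> B * norm x"
    and f: "clinear f" unfolding bounded_clinear_def by blast
  show ?thesis
  proof (rule bounded_linear_intro[of _ B])
    show "f (r *\<^sub>R x) = r *\<^sub>R f x" for r x
      using f unfolding clinear_def by (metis scaleC_of_real)
  qed (use f B in \<open>auto simp: clinear_def mult.commute\<close>)
qed

lemma cinner_cadjoint:
  fixes f :: "'a::chilbert_space \<Rightarrow> 'b::complex_inner"
  assumes "bounded_clinear f"
  shows "cinner (f x) y = cinner x (cadjoint f y)"
proof -
  have "\<exists>z. \<forall>x. cinner (f x) y = cinner x z" for y
  proof -
    have "bounded_linear (\<lambda>x. inner (f x) y)"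
      using bounded_linear_compose[OF bounded_linear_inner_left
          bounded_clinear_bounded_linear[OF assms]] .
    then obtain z where z: "\<And>x. inner (f x) y = inner x z"
      using riesz_representation by blast
    have "cinner (f x) y = cinner x z" for x
    proof (rule complex_eqI)
      show "Re (cinner (f x) y) = Re (cinner x z)"
        by (simp add: Re_cinner z)
      \<comment> \<open>The imaginary part of a sesquilinear form is its real part at \<open>- \<i> x\<close>.\<close>
      have "f ((- \<i>) *\<^sub>C x) = (- \<i>) *\<^sub>C f x"
        using assms by (simp add: bounded_clinear_def clinear_def)
      then have "Re (cinner ((- \<i>) *\<^sub>C f x) y) = Re (cinner ((- \<i>) *\<^sub>C x) z)"
        using z[of "(- \<i>) *\<^sub>C x"] by (simp add: Re_cinner)
      then show "Im (cinner (f x) y) = Im (cinner x z)"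
        by (simp add: cinner_scaleC_left)
    qed
    then show ?thesis by blast
  qed
  then have "\<exists>g. \<forall>x y. cinner (f x) y = cinner x (g y)" by metis
  then have "\<forall>x y. cinner (f x) y = cinner x (cadjoint f y)"
    unfolding cadjoint_def by (rule someI_ex)
  then show ?thesis by blast
qed

lemma inner_cadjoint:
  fixes f :: "'a::chilbert_space \<Rightarrow> 'b::complex_inner"
  assumes "bounded_clinear f"
  shows "inner (f x) y = inner x (cadjoint f y)"
  by (simp only: Re_cinner[symmetric] cinner_cadjoint[OF assms])

lemma cadjoint_eqI:
  fixes f :: "'a::chilbert_space \<Rightarrow> 'b::complex_inner"
  assumes "bounded_clinear f" "\<And>x y. inner (f x) y = inner x (g y)"
  shows "cadjoint f = g"
proof
  fix y
  have "inner x (cadjoint f y) = inner x (g y)" for x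
    by (simp only: inner_cadjoint[OF assms(1), symmetric] assms(2))
  then show "cadjoint f y = g y" by (rule inner_ext)
qed

lemma clinear_cadjoint:
  fixes f :: "'a::chilbert_space \<Rightarrow> 'b::complex_inner"
  assumes f: "bounded_clinear f"
  shows "clinear (cadjoint f)"
  unfolding clinear_def
proof (intro conjI allI)
  fix x y
  have "inner z (cadjoint f (x + y)) = inner z (cadjoint f x + cadjoint f y)" for z
    by (simp add: inner_cadjoint[OF f, symmetric] inner_add_right)
  then show "cadjoint f (x + y) = cadjoint f x + cadjoint f y"
    by (rule inner_ext)
next
  fix c x
  have "inner z (cadjoint f (c *\<^sub>C x)) = inner z (c *\<^sub>C cadjoint f x)" for z
    by (simp only: Re_cinner[symmetric] cinner_cadjoint[OF f, symmetric] cinner_scaleC_right)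
  then show "cadjoint f (c *\<^sub>C x) = c *\<^sub>C cadjoint f x"
    by (rule inner_ext)
qed

lemma bounded_clinear_comp:
  assumes "bounded_clinear f" "bounded_clinear g"
  shows "bounded_clinear (f \<circ> g)"
proof -
  have "bounded_linear (\<lambda>x. f (g x))"
    using bounded_linear_compose[OF bounded_clinear_bounded_linear[OF assms(1)]
        bounded_clinear_bounded_linear[OF assms(2)]] .
  then obtain B where "\<forall>x. norm (f (g x)) \<le> norm x * B"
    using bounded_linear.bounded by blast
  then show ?thesis
    using assms by (auto simp: bounded_clinear_def clinear_def mult.commute)
qed

lemma bounded_clinear_word_op:
  fixes T :: "'e \<Rightarrow> 'a::complex_inner \<Rightarrow> 'a"
  assumes "\<forall>e\<in>set w. bounded_clinear (T e)"
  shows "bounded_clinear (word_op T w)"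
  using assms
proof (induction w)
  case Nil
  have "\<exists>B. \<forall>x :: 'a. norm x \<le> B * norm x" by (rule exI[of _ 1]) simp
  then show ?case unfolding word_op_def bounded_clinear_def clinear_def by auto
next
  case (Cons e w)
  then show ?case using bounded_clinear_comp[of "T e" "word_op T w"] by (simp add: word_op_def comp_def)
qed

lemma cadjoint_word_op:
  fixes T :: "'e \<Rightarrow> 'a::chilbert_space \<Rightarrow> 'a"
  assumes "\<forall>e\<in>set w. bounded_clinear (T e)"
  shows "cadjoint (word_op T w) = fold (\<lambda>e. cadjoint (T e)) w"
proof (rule cadjoint_eqI[OF bounded_clinear_word_op[OF assms]])
  show "inner (word_op T w x) y = inner x (fold (\<lambda>e. cadjoint (T e)) w y)" for x y
    using assms
  proof (induction w arbitrary: x y)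
    case (Cons e w)
    then have "bounded_clinear (T e)" by simp
    from inner_cadjoint[OF this, of "word_op T w x" y] Cons show ?case
      by (simp add: word_op_def)
  qed (simp add: word_op_def)
qed

section \<open>Energy of words\<close>

text \<open>
  This turns norm estimates into orthogonality: for \<open>f i = \<parallel>A\<^sub>i x\<parallel>\<^sup>2\<close> with sum at most \<open>\<parallel>x\<parallel>\<^sup>2\<close>, a
  vector whose norm is preserved by one of the operators is killed by all the others.
\<close>

lemma has_sum_exhausted:
  fixes f :: "'i \<Rightarrow> real"
  assumes "(f has_sum s) I" "\<And>i. i \<in> I \<Longrightarrow> f i \<ge> 0" "i \<in> I" "j \<in> I" "i \<noteq> j" "s \<le> f i"
  shows "f j = 0"
proof -
  have "sum f {i, j} \<le> s"
    using assms by (intro finite_sum_le_has_sum) auto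
  then show ?thesis using assms by (auto intro: antisym)
qed

definition words :: "'i set \<Rightarrow> nat \<Rightarrow> 'i list set" where
  "words I d = {w. length w = d \<and> set w \<subseteq> I}"

text \<open>
  \<open>fold\<close> applies the first letter first, so for \<open>A\<^sub>i = S\<^sub>i\<^sup>*\<close> the operator \<open>fold A w\<close> is \<open>w(S)\<^sup>*\<close>.
\<close>

definition energy :: "'i set \<Rightarrow> ('i \<Rightarrow> 'a \<Rightarrow> 'a::real_normed_vector) \<Rightarrow> nat \<Rightarrow> 'a \<Rightarrow> real" where
  "energy I A d x = (\<Sum>\<^sub>\<infinity>w\<in>words I d. (norm (fold A w x))\<^sup>2)"

lemma words_0: "words I 0 = {[]}"
  by (auto simp: words_def)

lemma bij_betw_words_Suc:
  "bij_betw (\<lambda>(i, w). i # w) (I \<times> words I d) (words I (Suc d))"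
  by (rule bij_betw_byWitness[where f' = "\<lambda>w. (hd w, tl w)"])
    (auto simp: words_def length_Suc_conv)

text \<open>
  Summing over all words removes the graph from the sums and allows the first letter to be split
  off without regard to the rest of the word.
\<close>

lemma energy_cong_paths:
  fixes A :: "'e \<Rightarrow> 'a::real_normed_vector \<Rightarrow> 'a"
  assumes zero: "\<And>e. e \<in> arcs G \<Longrightarrow> A e 0 = 0"
    and broken: "\<And>a b x. a \<in> arcs G \<Longrightarrow> b \<in> arcs G \<Longrightarrow> tail G a \<noteq> head G b \<Longrightarrow> A b (A a x) = 0"
  shows "(\<Sum>\<^sub>\<infinity>w\<in>paths G d. (norm (fold A w x))\<^sup>2) = energy (arcs G) A d x"
proof -
  have fold_zero: "fold A w 0 = 0" if "set w \<subseteq> arcs G" for w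
    using that zero by (induction w) auto
  have "fold A w x = 0" if w: "set w \<subseteq> arcs G" and j: "Suc j < length w"
    and ne: "tail G (w ! j) \<noteq> head G (w ! Suc j)" for w j
  proof -
    have "w = take j w @ w ! j # w ! Suc j # drop (Suc (Suc j)) w"
      using j by (simp add: Cons_nth_drop_Suc)
    then have "fold A w x = fold A (drop (Suc (Suc j)) w) (A (w ! Suc j) (A (w ! j) (fold A (take j w) x)))"
      by (metis fold_append fold_simps(2) comp_apply)
    also have "\<dots> = 0"
      using w j ne fold_zero[of "drop (Suc (Suc j)) w"] set_drop_subset[of "Suc (Suc j)" w]
      by (subst broken) (auto simp: subset_iff)
    finally show ?thesis .
  qed
  then show ?thesis
    unfolding energy_def by (intro infsum_cong_neutral) (auto simp: paths_def words_def)
qed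

locale column_contraction =
  fixes I :: "'i set" and A :: "'i \<Rightarrow> 'a::complex_inner \<Rightarrow> 'a"
  assumes clinear: "i \<in> I \<Longrightarrow> clinear (A i)"
    and column_sum: "\<exists>s\<le>(norm x)\<^sup>2. ((\<lambda>i. (norm (A i x))\<^sup>2) has_sum s) I"
begin

abbreviation E :: "nat \<Rightarrow> 'a \<Rightarrow> real" where "E \<equiv> energy I A"

lemma energy_nonneg: "E d x \<ge> 0"
  unfolding energy_def by (rule infsum_nonneg) simp

text \<open>
  Both claims go through one induction: the bound for length \<open>d\<close> provides the series dominating the
  sum over the first letter.
\<close>

lemma energy_summable_le:
  "(\<lambda>w. (norm (fold A w x))\<^sup>2) summable_on words I d \<and> E d x \<le> (norm x)\<^sup>2"
proof (induction d arbitrary: x)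
  case 0
  then show ?case by (simp add: words_0 energy_def)
next
  case (Suc d)
  obtain s where s: "s \<le> (norm x)\<^sup>2" "((\<lambda>i. (norm (A i x))\<^sup>2) has_sum s) I"
    using column_sum by blast
  have inner_sum: "((\<lambda>w. (norm (fold A w (A i x)))\<^sup>2) has_sum E d (A i x)) (words I d)" for i
    using Suc[of "A i x"] by (simp add: energy_def)
  have "(\<lambda>i. E d (A i x)) summable_on I"
    by (rule summable_on_comparison_test[of "\<lambda>i. (norm (A i x))\<^sup>2"])
      (use s Suc energy_nonneg in \<open>auto simp: summable_on_def\<close>)
  then obtain t where t: "((\<lambda>i. E d (A i x)) has_sum t) I"
    by (auto simp: summable_on_def)
  have "t \<le> s" by (rule has_sum_mono[OF t s(2)]) (use Suc in auto)
  have "((\<lambda>(i, w). (norm (fold A w (A i x)))\<^sup>2) has_sum t) (I \<times> words I d)"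
    by (rule has_sum_SigmaI[OF _ t])
      (use inner_sum t in \<open>auto intro!: summable_on_SigmaI[OF _ has_sum_imp_summable[OF t]]\<close>)
  then have "((\<lambda>w. (norm (fold A w x))\<^sup>2) has_sum t) (words I (Suc d))"
    by (subst has_sum_reindex_bij_betw[OF bij_betw_words_Suc, symmetric])
      (simp add: case_prod_unfold)
  then show ?case
    using \<open>t \<le> s\<close> s(1) by (auto simp: energy_def summable_on_def infsumI)
qed

lemma energy_summable: "(\<lambda>w. (norm (fold A w x))\<^sup>2) summable_on words I d"
  and energy_le: "E d x \<le> (norm x)\<^sup>2"
  using energy_summable_le by auto

lemma energy_Suc: "((\<lambda>i. E d (A i x)) has_sum E (Suc d) x) I"
proof -
  have "((\<lambda>w. (norm (fold A w x))\<^sup>2) has_sum E (Suc d) x) (words I (Suc d))"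
    unfolding energy_def by (rule has_sum_infsum[OF energy_summable])
  then have "((\<lambda>p. (norm (fold A (case p of (i, w) \<Rightarrow> i # w) x))\<^sup>2) has_sum E (Suc d) x)
      (I \<times> words I d)"
    by (subst (asm) has_sum_reindex_bij_betw[OF bij_betw_words_Suc, symmetric])
  then show ?thesis
    by (rule has_sum_SigmaD) (simp add: energy_def energy_summable)
qed

lemma fold_clinear:
  assumes "set w \<subseteq> I" shows "clinear (fold A w)"
  using assms
proof (induction w)
  case (Cons i w)
  then show ?case using clinear[of i] by (simp add: clinear_def)
qed (simp add: clinear_def)

text \<open>
  The parallelogram law, word by word. The factor \<open>2\<close> is harmless for limits \<open>0\<close>.
\<close>

lemma energy_add_le: "E d (x + y) \<le> 2 * E d x + 2 * E d y"
proof -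
  have "E d (x + y) \<le> (\<Sum>\<^sub>\<infinity>w\<in>words I d. 2 * (norm (fold A w x))\<^sup>2 + 2 * (norm (fold A w y))\<^sup>2)"
    unfolding energy_def
  proof (rule infsum_mono[OF energy_summable])
    show "(\<lambda>w. 2 * (norm (fold A w x))\<^sup>2 + 2 * (norm (fold A w y))\<^sup>2) summable_on words I d"
      by (intro summable_on_add summable_on_cmult_right energy_summable)
    fix w assume w: "w \<in> words I d"
    let ?u = "fold A w x" and ?v = "fold A w y"
    have "fold A w (x + y) = ?u + ?v"
      using w fold_clinear by (auto simp: words_def clinear_def)
    then have "(norm (fold A w (x + y)))\<^sup>2 + (norm (?u - ?v))\<^sup>2 = 2 * (norm ?u)\<^sup>2 + 2 * (norm ?v)\<^sup>2"
      by (simp add: power2_norm_eq_inner inner_simps)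
    then show "(norm (fold A w (x + y)))\<^sup>2 \<le> 2 * (norm ?u)\<^sup>2 + 2 * (norm ?v)\<^sup>2"
      using zero_le_power2[of "norm (?u - ?v)"] by linarith
  qed
  also have "\<dots> = 2 * E d x + 2 * E d y"
    unfolding energy_def
    by (subst infsum_add) (auto intro!: summable_on_cmult_right energy_summable simp: infsum_cmult_right')
  finally show ?thesis .
qed

lemma energy_scaleC: "E d (c *\<^sub>C x) = (cmod c)\<^sup>2 * E d x"
proof -
  have "E d (c *\<^sub>C x) = (\<Sum>\<^sub>\<infinity>w\<in>words I d. (cmod c)\<^sup>2 * (norm (fold A w x))\<^sup>2)"
    unfolding energy_def
  proof (rule infsum_cong)
    fix w assume "w \<in> words I d"
    then have "fold A w (c *\<^sub>C x) = c *\<^sub>C fold A w x"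
      using fold_clinear by (auto simp: words_def clinear_def)
    then show "(norm (fold A w (c *\<^sub>C x)))\<^sup>2 = (cmod c)\<^sup>2 * (norm (fold A w x))\<^sup>2"
      by (simp add: norm_scaleC power_mult_distrib)
  qed
  then show ?thesis by (simp add: energy_def infsum_cmult_right')
qed

lemma energy_zero: "E d 0 = 0"
  using energy_le[of d 0] energy_nonneg[of d 0] by simp

definition vanishing :: "'a set" where
  "vanishing = {x. (\<lambda>d. E d x) \<longlonglongrightarrow> 0}"

lemma vanishing_subspace: "module.subspace scaleC vanishing"
proof -
  interpret vector_space "scaleC :: complex \<Rightarrow> 'a \<Rightarrow> 'a" by (rule vector_space_scaleC)
  show ?thesis
  proof (rule subspaceI)
    show "0 \<in> vanishing" by (simp add: vanishing_def energy_zero)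
  next
    fix x y assume "x \<in> vanishing" "y \<in> vanishing"
    then have "(\<lambda>d. 2 * E d x + 2 * E d y) \<longlonglongrightarrow> 0"
      unfolding vanishing_def by (auto intro!: tendsto_eq_intros)
    then show "x + y \<in> vanishing"
      unfolding vanishing_def mem_Collect_eq
      by (rule tendsto_sandwich[OF _ _ tendsto_const, rotated 2]) (simp_all add: energy_nonneg energy_add_le)
  next
    fix c x assume "x \<in> vanishing"
    then show "c *\<^sub>C x \<in> vanishing"
      unfolding vanishing_def by (auto simp: energy_scaleC intro: tendsto_mult_right_zero)
  qed
qed

text \<open>
  The energy at \<open>x\<close> is at most \<open>2 E d y + 2 \<parallel>x - y\<parallel>\<^sup>2\<close>, and the second term does not depend on \<open>d\<close>.
\<close>

lemma vanishing_closed: "closed vanishing"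
proof -
  have "x \<in> vanishing" if x: "x \<in> closure vanishing" for x
    unfolding vanishing_def mem_Collect_eq
  proof (rule LIMSEQ_I)
    fix e :: real assume "e > 0"
    then have "sqrt (e / 4) > 0" by simp
    then obtain y where y: "y \<in> vanishing" "dist y x < sqrt (e / 4)"
      using x closure_approachable by blast
    have small: "(norm (x - y))\<^sup>2 < e / 4"
    proof -
      have "(norm (x - y))\<^sup>2 < (sqrt (e / 4))\<^sup>2"
        using y(2) by (intro power_strict_mono) (auto simp: dist_norm norm_minus_commute)
      then show ?thesis using \<open>e > 0\<close> by simp
    qed
    obtain N where N: "\<And>d. d \<ge> N \<Longrightarrow> norm (E d y - 0) < e / 4"
      using y(1) LIMSEQ_D[of "\<lambda>d. E d y" 0 "e / 4"] \<open>e > 0\<close> unfolding vanishing_def by auto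
    have "norm (E d x - 0) < e" if "d \<ge> N" for d
      using energy_add_le[of d y "x - y"] energy_le[of d "x - y"] small N[OF that]
        energy_nonneg[of d x] by simp
    then show "\<exists>N. \<forall>d\<ge>N. norm (E d x - 0) < e" by blast
  qed
  then show ?thesis by (metis closure_subset closure_eq subset_antisym subsetI)
qed

end

text \<open>
  \<open>\<Sum>\<^sub>i T\<^sub>i T\<^sub>i\<^sup>* \<le> I\<close> says that the column of the adjoints is a contraction: pair the sum with a
  vector.
\<close>

lemma row_contraction_column:
  fixes T :: "nat \<Rightarrow> 'a::chilbert_space \<Rightarrow> 'a"
  assumes "nonzero_operators n T" "row_contraction n T"
  shows "column_contraction (idx n) (\<lambda>i. cadjoint (T i))"
proof
  have bd: "bounded_clinear (T i)" if "i \<in> idx n" for i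
    using assms(1) that by (simp add: nonzero_operators_def)
  then show "clinear (cadjoint (T i))" if "i \<in> idx n" for i
    using that clinear_cadjoint by blast
  fix x
  obtain B where B: "sot_has_sum (\<lambda>i. T i \<circ> cadjoint (T i)) (idx n) B" "op_le B id"
    using assms(2) by (auto simp: row_contraction_def)
  have "((\<lambda>i. (T i \<circ> cadjoint (T i)) x) has_sum B x) (idx n)"
    using B(1) by (simp add: sot_has_sum_def)
  from has_sum_bounded_linear[OF bounded_linear_inner_left[of x] this]
  have "((\<lambda>i. inner (T i (cadjoint (T i) x)) x) has_sum inner (B x) x) (idx n)"
    by simp
  then have "((\<lambda>i. (norm (cadjoint (T i) x))\<^sup>2) has_sum inner (B x) x) (idx n)"
    by (rule has_sum_cong[THEN iffD1, rotated]) (simp add: inner_cadjoint[OF bd] power2_norm_eq_inner)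
  moreover have "inner (B x) x \<le> (norm x)\<^sup>2"
    using B(2) by (simp add: op_le_def Re_cinner inner_simps power2_norm_eq_inner)
  ultimately show "\<exists>s\<le>(norm x)\<^sup>2. ((\<lambda>i. (norm (cadjoint (T i) x))\<^sup>2) has_sum s) (idx n)"
    by blast
qed

section \<open>Tuples with a stabilizing family\<close>

lemma projection_inner:
  fixes P :: "'a::chilbert_space \<Rightarrow> 'a"
  assumes "is_projection P"
  shows "inner (P x) y = inner x (P y)" "inner (P x) x = (norm (P x))\<^sup>2" "P (P x) = P x"
proof -
  have P: "bounded_clinear P" "P \<circ> P = P" "cadjoint P = P"
    using assms by (auto simp: is_projection_def)
  show sa: "inner (P x) y = inner x (P y)" for x y
    using inner_cadjoint[OF P(1)] P(3) by simp
  show idem: "P (P x) = P x" for x using fun_cong[OF P(2), of x] by simp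
  show "inner (P x) x = (norm (P x))\<^sup>2"
    by (metis sa idem power2_norm_eq_inner)
qed

text \<open>On the range of \<open>P\<^sub>l\<close>, the term \<open>P\<^sub>l\<close> already exhausts \<open>\<Sum>\<^sub>k \<parallel>P\<^sub>k x\<parallel>\<^sup>2 = \<parallel>x\<parallel>\<^sup>2\<close>.\<close>

lemma stabilizing_orthogonal:
  fixes P :: "'j \<Rightarrow> 'a::chilbert_space \<Rightarrow> 'a"
  assumes "stabilizes J P n T" "k \<in> J" "l \<in> J" "k \<noteq> l"
  shows "P k (P l y) = 0"
proof -
  have proj: "is_projection (P k)" if "k \<in> J" for k
    using assms(1) that by (simp add: stabilizes_def)
  define x where "x = P l y"
  have "((\<lambda>k. P k x) has_sum x) J"
    using assms(1) by (simp add: stabilizes_def sot_has_sum_def)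
  from has_sum_bounded_linear[OF bounded_linear_inner_left[of x] this]
  have "((\<lambda>k. (norm (P k x))\<^sup>2) has_sum (norm x)\<^sup>2) J"
    unfolding power2_norm_eq_inner[of x]
    by (rule has_sum_cong[THEN iffD1, rotated]) (simp add: projection_inner(2)[OF proj])
  then have "(norm (P k x))\<^sup>2 = 0"
    by (rule has_sum_exhausted[of _ _ _ l])
      (use assms in \<open>auto simp: x_def projection_inner(3)[OF proj]\<close>)
  then show ?thesis by (simp add: x_def)
qed

text \<open>
  The vertices of an edge are well defined: two candidates would carry orthogonal projections,
  forcing \<open>T\<^sub>i = 0\<close>, and if no projection fixed \<open>T\<^sub>i\<close>, then all would annihilate it, and so would
  their sum \<open>I\<close>.
\<close>

lemma stabilizing_graph_tail_head:
  fixes T :: "nat \<Rightarrow> 'a::chilbert_space \<Rightarrow> 'a"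
  assumes T: "nonzero_operators n T" and st: "stabilizes J P n T" and i: "i \<in> idx n"
  shows "tail (stabilizing_graph J P n T) i \<in> J \<and> T i \<circ> P (tail (stabilizing_graph J P n T) i) = T i"
    and "head (stabilizing_graph J P n T) i \<in> J \<and> P (head (stabilizing_graph J P n T) i) \<circ> T i = T i"
proof -
  have bd: "bounded_clinear (T i)" and nz: "T i \<noteq> zero_op"
    using T i by (auto simp: nonzero_operators_def)
  have T0: "T i 0 = 0" using bd clinear_zero by (auto simp: bounded_clinear_def)
  have dich: "P k \<circ> T i \<in> {T i, zero_op}" "T i \<circ> P k \<in> {T i, zero_op}" if "k \<in> J" for k
    using st i that by (auto simp: stabilizes_def)
  have sum: "((\<lambda>k. P k x) has_sum x) J" for x
    using st by (simp add: stabilizes_def sot_has_sum_def)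
  have "\<exists>!k. k \<in> J \<and> T i \<circ> P k = T i"
  proof (rule ex_ex1I)
    show "\<exists>k. k \<in> J \<and> T i \<circ> P k = T i"
    proof (rule ccontr)
      assume "\<not> ?thesis"
      then have z: "T i (P k x) = 0" if "k \<in> J" for k x
        using dich(2)[OF that] that by (metis comp_apply empty_iff insert_iff zero_op_def)
      have "T i x = 0" for x
      proof -
        have "((\<lambda>k. T i (P k x)) has_sum T i x) J"
          by (rule has_sum_bounded_linear[OF bounded_clinear_bounded_linear[OF bd] sum])
        moreover have "((\<lambda>k. T i (P k x)) has_sum 0) J" using z by (rule has_sum_0)
        ultimately show ?thesis by (rule has_sum_unique)
      qed
      then show False using nz by (auto simp: zero_op_def)
    qed
    fix k l assume kl: "k \<in> J \<and> T i \<circ> P k = T i" "l \<in> J \<and> T i \<circ> P l = T i"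
    show "k = l"
    proof (rule ccontr)
      assume ne: "k \<noteq> l"
      have "T i x = 0" for x
        using kl stabilizing_orthogonal[OF st _ _ ne, of x] T0 by (metis comp_apply)
      then show False using nz by (auto simp: zero_op_def)
    qed
  qed
  from theI'[OF this]
  show "tail (stabilizing_graph J P n T) i \<in> J \<and> T i \<circ> P (tail (stabilizing_graph J P n T) i) = T i"
    by (simp add: stabilizing_graph_def)
  have "\<exists>!k. k \<in> J \<and> P k \<circ> T i = T i"
  proof (rule ex_ex1I)
    show "\<exists>k. k \<in> J \<and> P k \<circ> T i = T i"
    proof (rule ccontr)
      assume "\<not> ?thesis"
      then have z: "P k (T i x) = 0" if "k \<in> J" for k x
        using dich(1)[OF that] that by (metis comp_apply empty_iff insert_iff zero_op_def)
      have "T i x = 0" for x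
        by (rule has_sum_unique[OF sum has_sum_0]) (use z in auto)
      then show False using nz by (auto simp: zero_op_def)
    qed
    fix k l assume kl: "k \<in> J \<and> P k \<circ> T i = T i" "l \<in> J \<and> P l \<circ> T i = T i"
    show "k = l"
    proof (rule ccontr)
      assume ne: "k \<noteq> l"
      have "T i x = 0" for x
        using kl stabilizing_orthogonal[OF st _ _ ne, of "T i x"] by (metis comp_apply)
      then show False using nz by (auto simp: zero_op_def)
    qed
  qed
  from theI'[OF this]
  show "head (stabilizing_graph J P n T) i \<in> J \<and> P (head (stabilizing_graph J P n T) i) \<circ> T i = T i"
    by (simp add: stabilizing_graph_def)
qed

lemma path_sum_stabilized:
  fixes T :: "nat \<Rightarrow> 'a::chilbert_space \<Rightarrow> 'a"
  assumes T: "nonzero_operators n T" and st: "stabilizes J P n T"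
  shows "(\<Sum>\<^sub>\<infinity>w\<in>paths (stabilizing_graph J P n T) d. (norm (cadjoint (word_op T w) \<xi>))\<^sup>2)
    = energy (idx n) (\<lambda>i. cadjoint (T i)) d \<xi>"
proof -
  let ?G = "stabilizing_graph J P n T"
  have arcs: "arcs ?G = idx n" by (simp add: stabilizing_graph_def)
  have bd: "bounded_clinear (T i)" if "i \<in> idx n" for i
    using T that by (simp add: nonzero_operators_def)
  have T0: "T i 0 = 0" if "i \<in> idx n" for i
    using bd[OF that] clinear_zero by (auto simp: bounded_clinear_def)
  have broken: "cadjoint (T b) (cadjoint (T a) x) = 0"
    if a: "a \<in> idx n" and b: "b \<in> idx n" and ne: "tail ?G a \<noteq> head ?G b" for a b x
  proof -
    have "T a (T b y) = 0" for y
      using stabilizing_graph_tail_head(1)[OF T st a] stabilizing_graph_tail_head(2)[OF T st b]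
        stabilizing_orthogonal[OF st _ _ ne, of "T b y"] T0[OF a] by (metis comp_apply)
    then have "inner y (cadjoint (T b) (cadjoint (T a) x)) = inner y 0" for y
      by (simp add: inner_cadjoint[OF bd[OF a], symmetric] inner_cadjoint[OF bd[OF b], symmetric])
    then show ?thesis by (rule inner_ext)
  qed
  have "(\<Sum>\<^sub>\<infinity>w\<in>paths ?G d. (norm (cadjoint (word_op T w) \<xi>))\<^sup>2)
    = (\<Sum>\<^sub>\<infinity>w\<in>paths ?G d. (norm (fold (\<lambda>i. cadjoint (T i)) w \<xi>))\<^sup>2)"
    by (rule infsum_cong) (use bd in \<open>auto simp: paths_def arcs cadjoint_word_op subset_iff\<close>)
  also have "\<dots> = energy (arcs ?G) (\<lambda>i. cadjoint (T i)) d \<xi>"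
    by (rule energy_cong_paths)
      (use broken bd in \<open>auto simp: arcs clinear_zero[OF clinear_cadjoint]\<close>)
  finally show ?thesis by (simp add: arcs)
qed

section \<open>Tuples satisfying the relations of a graph\<close>

locale dagger_tuple =
  fixes n :: enat and S :: "nat \<Rightarrow> 'k::chilbert_space \<Rightarrow> 'k"
  assumes dagger: "dagger n S"
begin

abbreviation A :: "nat \<Rightarrow> 'k \<Rightarrow> 'k" where "A i \<equiv> cadjoint (S i)"
abbreviation Q :: "nat \<Rightarrow> 'k \<Rightarrow> 'k" where "Q \<equiv> initial_op S"

lemma bounded: "i \<in> idx n \<Longrightarrow> bounded_clinear (S i)"
  and nonzero: "i \<in> idx n \<Longrightarrow> S i \<noteq> zero_op"
  using dagger by (auto simp: dagger_def nonzero_operators_def)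

sublocale column_contraction "idx n" A
  using dagger by (auto simp: dagger_def intro: row_contraction_column)

lemma inner_A: "i \<in> idx n \<Longrightarrow> inner x (A i y) = inner (S i x) y"
  using inner_cadjoint[OF bounded] by simp

lemma inner_Q: "i \<in> idx n \<Longrightarrow> inner (Q i x) y = inner (S i x) (S i y)"
  by (metis initial_op_def comp_apply inner_A inner_commute)

lemma Q_symmetric: "i \<in> idx n \<Longrightarrow> inner (Q i x) y = inner x (Q i y)"
  by (metis inner_Q inner_commute)

lemma Q_idem: "i \<in> idx n \<Longrightarrow> Q i (Q i x) = Q i x"
  using dagger unfolding dagger_def by (metis comp_apply)

lemma A_diff: "i \<in> idx n \<Longrightarrow> A i (x - y) = A i x - A i y"
  by (rule clinear_diff[OF clinear])

lemma S_diff: "i \<in> idx n \<Longrightarrow> S i (x - y) = S i x - S i y"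
  by (rule clinear_diff[OF bounded_clinear_clinear[OF bounded]])

lemma Q_diff: "i \<in> idx n \<Longrightarrow> Q i (x - y) = Q i x - Q i y"
  by (simp add: initial_op_def S_diff A_diff)

lemma norm_Q: "i \<in> idx n \<Longrightarrow> norm (Q i x) = norm (S i x)"
  by (metis inner_Q Q_idem Q_symmetric norm_eq)

lemma S_Q: assumes i: "i \<in> idx n" shows "S i (Q i x) = S i x"
proof -
  have "norm (S i (x - Q i x)) = 0"
    using norm_Q[OF i, of "x - Q i x"] by (simp add: Q_diff Q_idem i)
  then show ?thesis by (simp add: S_diff i)
qed

lemma Q_A: assumes i: "i \<in> idx n" shows "Q i (A i x) = A i x"
proof -
  have "inner y (Q i (A i x)) = inner y (A i x)" for y
    by (metis Q_symmetric S_Q i inner_A)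
  then show ?thesis by (rule inner_ext)
qed

text \<open>
  The partial isometry \<open>S\<^sub>i\<^sup>*\<close> preserves the norm of \<open>S\<^sub>i y\<close>, which leaves nothing for the other
  adjoints.
\<close>

lemma range_orthogonal:
  assumes "i \<in> idx n" "j \<in> idx n" "i \<noteq> j"
  shows "A j (S i y) = 0"
proof -
  obtain s where s: "s \<le> (norm (S i y))\<^sup>2" "((\<lambda>j. (norm (A j (S i y)))\<^sup>2) has_sum s) (idx n)"
    using column_sum by blast
  have "A i (S i y) = Q i y" by (simp add: initial_op_def)
  then have "(norm (A j (S i y)))\<^sup>2 = 0"
    using s assms norm_Q by (intro has_sum_exhausted[OF s(2)]) auto
  then show ?thesis by simp
qed

text \<open>
  \<open>S\<^sub>i S\<^sub>i\<^sup>* \<le> Q\<^sub>j\<close> bounds \<open>\<parallel>S\<^sub>i\<^sup>* x\<parallel>\<close> by \<open>\<parallel>Q\<^sub>j x\<parallel>\<close>, so \<open>S\<^sub>i\<^sup>*\<close> vanishes on the kernel of \<open>Q\<^sub>j\<close>.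
\<close>

lemma A_Q_final:
  assumes i: "i \<in> idx n" and j: "j \<in> idx n" and le: "op_le (S i \<circ> A i) (Q j)"
  shows "A i (Q j x) = A i x"
proof -
  let ?y = "x - Q j x"
  have "inner (S i (A i ?y)) ?y \<le> inner (Q j ?y) ?y"
    using le[unfolded op_le_def, THEN spec, of ?y]
    by (simp only: comp_apply Re_cinner inner_diff_left) simp
  moreover have "inner (S i (A i ?y)) ?y = (norm (A i ?y))\<^sup>2"
    by (metis inner_A i power2_norm_eq_inner)
  moreover have "Q j ?y = 0" by (simp add: Q_diff Q_idem j)
  ultimately have "(norm (A i ?y))\<^sup>2 \<le> 0" by simp
  then show ?thesis by (simp add: A_diff i)
qed

lemma final_exists: "i \<in> idx n \<Longrightarrow> \<exists>j\<in>idx n. op_le (S i \<circ> A i) (Q j)"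
  using dagger unfolding dagger_def by blast

lemma Q_dichotomy:
  "i \<in> idx n \<Longrightarrow> j \<in> idx n \<Longrightarrow> Q i \<noteq> Q j \<Longrightarrow> Q i (Q j x) = 0"
  using dagger unfolding dagger_def by (metis comp_apply zero_op_def)

lemma A_zero: "i \<in> idx n \<Longrightarrow> A i 0 = 0"
  by (rule clinear_zero[OF clinear])

lemma A_nonzero: assumes i: "i \<in> idx n" shows "\<exists>x. A i x \<noteq> 0"
proof (rule ccontr)
  assume "\<not> ?thesis"
  then have "inner (S i x) (S i x) = 0" for x
    using inner_A[OF i, of x "S i x"] by simp
  then show False using nonzero[OF i] by (auto simp: zero_op_def)
qed

text \<open>
  \<open>S\<^sub>e\<^sup>*\<close> factors through the projection at the final vertex of \<open>e\<close>, which equals \<open>Q\<^sub>i\<close> or is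
  orthogonal to it.
\<close>

lemma A_Q_dichotomy:
  assumes "e \<in> idx n" "i \<in> idx n"
  shows "(\<forall>x. A e (Q i x) = A e x) \<or> (\<forall>x. A e (Q i x) = 0)"
proof -
  obtain j where j: "j \<in> idx n" "op_le (S e \<circ> A e) (Q j)" using final_exists assms by blast
  show ?thesis
  proof (cases "Q j = Q i")
    case True
    then show ?thesis using A_Q_final[OF assms(1) j] by simp
  next
    case False
    then have "A e (Q i x) = 0" for x
      using A_Q_final[OF assms(1) j, of "Q i x"] Q_dichotomy[OF j(1) assms(2)] A_zero assms(1)
      by simp
    then show ?thesis by blast
  qed
qed

text \<open>
  The final vertex is unique: \<open>S\<^sub>i\<^sup>*\<close> would factor through the product of two candidates, which is
  \<open>0\<close>.
\<close>

lemma dagger_graph_head: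
  assumes i: "i \<in> idx n"
  obtains j where "j \<in> idx n" "head (dagger_graph n S) i = Q j" "op_le (S i \<circ> A i) (Q j)"
proof -
  have "\<exists>!R. R \<in> Q ` idx n \<and> op_le (S i \<circ> A i) R"
  proof (rule ex_ex1I)
    show "\<exists>R. R \<in> Q ` idx n \<and> op_le (S i \<circ> A i) R" using final_exists[OF i] by blast
    fix R R' assume "R \<in> Q ` idx n \<and> op_le (S i \<circ> A i) R" "R' \<in> Q ` idx n \<and> op_le (S i \<circ> A i) R'"
    then obtain j k where j: "j \<in> idx n" "R = Q j" "op_le (S i \<circ> A i) (Q j)"
      and k: "k \<in> idx n" "R' = Q k" "op_le (S i \<circ> A i) (Q k)" by blast
    show "R = R'"
    proof (rule ccontr)
      assume "R \<noteq> R'"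
      then have "A i x = 0" for x
        using A_Q_final[OF i j(1,3), of "Q k x"] A_Q_final[OF i k(1,3), of x]
          Q_dichotomy[OF j(1) k(1), of x] A_zero[OF i] j k by simp
      then show False using A_nonzero[OF i] by blast
    qed
  qed
  from theI'[OF this]
  have "head (dagger_graph n S) i \<in> Q ` idx n \<and> op_le (S i \<circ> A i) (head (dagger_graph n S) i)"
    by (simp add: dagger_graph_def)
  then show ?thesis using that by (elim conjE imageE) metis
qed

lemma path_sum_dagger:
  "(\<Sum>\<^sub>\<infinity>w\<in>paths (dagger_graph n S) d. (norm (cadjoint (word_op S w) \<xi>))\<^sup>2) = E d \<xi>"
proof -
  let ?G = "dagger_graph n S"
  have G: "arcs ?G = idx n" "tail ?G = Q" by (simp_all add: dagger_graph_def)
  have broken: "A b (A a x) = 0"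
    if a: "a \<in> idx n" and b: "b \<in> idx n" and ne: "tail ?G a \<noteq> head ?G b" for a b x
  proof -
    obtain j where j: "j \<in> idx n" "head ?G b = Q j" "op_le (S b \<circ> A b) (Q j)"
      using dagger_graph_head[OF b] .
    have "A b (A a x) = A b (Q j (Q a (A a x)))"
      using A_Q_final[OF b j(1,3)] Q_A[OF a] by simp
    also have "\<dots> = 0"
      using Q_dichotomy[OF j(1) a] ne j(2) A_zero[OF b] by (simp add: G)
    finally show ?thesis .
  qed
  have "(\<Sum>\<^sub>\<infinity>w\<in>paths ?G d. (norm (cadjoint (word_op S w) \<xi>))\<^sup>2)
    = (\<Sum>\<^sub>\<infinity>w\<in>paths ?G d. (norm (fold A w \<xi>))\<^sup>2)"
    by (rule infsum_cong) (use bounded in \<open>auto simp: paths_def G cadjoint_word_op subset_iff\<close>)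
  also have "\<dots> = energy (arcs ?G) A d \<xi>"
    by (rule energy_cong_paths) (use broken A_zero in \<open>auto simp: G\<close>)
  finally show ?thesis by (simp add: G)
qed

lemma pure_iff_vanishing: "pure n S \<longleftrightarrow> vanishing = UNIV"
  by (auto simp: pure_def path_sum_dagger vanishing_def)

lemma energy_S:
  assumes i: "i \<in> idx n"
  shows "E (Suc d) (S i x) = E d (Q i x)"
proof -
  have "((\<lambda>j. E d (A j (S i x))) has_sum E d (A i (S i x))) {i}"
    using has_sum_finite[of "{i}" "\<lambda>j. E d (A j (S i x))"] by simp
  then have "((\<lambda>j. E d (A j (S i x))) has_sum E d (A i (S i x))) (idx n)"
    by (rule has_sum_cong_neutral[THEN iffD1, rotated -1])
      (use i range_orthogonal[OF i] in \<open>auto simp: energy_zero\<close>)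
  then show ?thesis
    using energy_Suc[of d "S i x"] has_sum_unique by (force simp: initial_op_def)
qed

text \<open>
  The adjoint of the first letter absorbs or kills \<open>Q\<^sub>i\<close>, so the inequality holds for each first
  letter separately.
\<close>

lemma energy_Q_le:
  assumes i: "i \<in> idx n"
  shows "E (Suc d) (Q i x) \<le> E (Suc d) x"
proof (rule has_sum_mono[OF energy_Suc energy_Suc])
  fix e assume "e \<in> idx n"
  then consider "A e (Q i x) = A e x" | "A e (Q i x) = 0" using A_Q_dichotomy i by blast
  then show "E d (A e (Q i x)) \<le> E d (A e x)"
    by cases (auto simp: energy_zero energy_nonneg)
qed

lemma vanishing_invariant:
  assumes i: "i \<in> idx n" and x: "x \<in> vanishing"
  shows "S i x \<in> vanishing"
proof -
  have "(\<lambda>d. E (Suc d) x) \<longlonglongrightarrow> 0" using x LIMSEQ_Suc by (auto simp: vanishing_def)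
  then have "(\<lambda>d. E (Suc (Suc d)) (S i x)) \<longlonglongrightarrow> 0"
    by (rule tendsto_sandwich[OF _ _ tendsto_const, rotated 2])
      (auto simp: energy_nonneg energy_S[OF i] energy_Q_le[OF i])
  then have "(\<lambda>d. E d (S i x)) \<longlonglongrightarrow> 0"
    by (intro LIMSEQ_imp_Suc[of "\<lambda>d. E d (S i x)"] LIMSEQ_imp_Suc[of "\<lambda>d. E (Suc d) (S i x)"])
  then show ?thesis by (simp add: vanishing_def)
qed

lemma vanishing_word:
  assumes "set w \<subseteq> idx n" "x \<in> vanishing"
  shows "word_op S w x \<in> vanishing"
  using assms by (induction w) (auto simp: word_op_def vanishing_invariant)

end

section \<open>Purity of minimal dilations\<close>

lemma energy_dilation:
  assumes "\<forall>h. norm (V h) = norm h" "\<forall>i\<in>I. \<forall>h. B i (V h) = V (A i h)"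
  shows "energy I B d (V h) = energy I A d h"
proof -
  have "fold B w (V h) = V (fold A w h)" if "set w \<subseteq> I" for w h
    using that assms(2) by (induction w arbitrary: h) auto
  then show ?thesis
    unfolding energy_def using assms(1) by (intro infsum_cong) (auto simp: words_def)
qed

theorem proposition3p4:
  fixes n :: enat
    and T :: "nat \<Rightarrow> 'h::chilbert_space \<Rightarrow> 'h"
    and J :: "'j set"
    and P :: "'j \<Rightarrow> 'h \<Rightarrow> 'h"
  assumes "n \<ge> 1"
    and "nonzero_operators n T"
    and "row_contraction n T"
    and "stabilizes J P n T"
    and "\<forall>k\<in>J. \<exists>i\<in>idx n. T i \<circ> P k \<noteq> zero_op"
  shows "\<forall>(V :: 'h \<Rightarrow> 'k::chilbert_space) S. minimal_pi_dilation n T V S \<longrightarrow>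
    (pure n S \<longleftrightarrow>
      (\<forall>\<xi>. (\<lambda>d. \<Sum>\<^sub>\<infinity>w\<in>paths (stabilizing_graph J P n T) d.
              (norm (cadjoint (word_op T w) \<xi>))\<^sup>2) \<longlonglongrightarrow> 0))"
proof (intro allI impI)
  fix V :: "'h \<Rightarrow> 'k" and S
  assume dil: "minimal_pi_dilation n T V S"
  interpret S: dagger_tuple n S
    using dil by unfold_locales (simp add: minimal_pi_dilation_def)
  have "S.E d (V \<xi>) = energy (idx n) (\<lambda>i. cadjoint (T i)) d \<xi>" for d \<xi>
    using dil by (intro energy_dilation) (auto simp: minimal_pi_dilation_def)
  then have T_iff: "(\<forall>\<xi>. (\<lambda>d. \<Sum>\<^sub>\<infinity>w\<in>paths (stabilizing_graph J P n T) d.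
      (norm (cadjoint (word_op T w) \<xi>))\<^sup>2) \<longlonglongrightarrow> 0) \<longleftrightarrow> range V \<subseteq> S.vanishing"
    unfolding path_sum_stabilized[OF assms(2,4)] S.vanishing_def image_subset_iff by simp
  have "S.vanishing = UNIV" if V: "range V \<subseteq> S.vanishing"
  proof -
    interpret vector_space "scaleC :: complex \<Rightarrow> 'k \<Rightarrow> 'k" by (rule vector_space_scaleC)
    let ?X = "range V \<union> (\<Union>w\<in>{w. w \<noteq> [] \<and> set w \<subseteq> idx n}. word_op S w ` range V)"
    have "?X \<subseteq> S.vanishing" using V S.vanishing_word by blast
    then have "cspan ?X \<subseteq> S.vanishing"
      unfolding cspan_def by (rule span_minimal[OF _ S.vanishing_subspace])
    then have "closure (cspan ?X) \<subseteq> S.vanishing"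
      by (rule closure_minimal[OF _ S.vanishing_closed])
    then show ?thesis using dil by (auto simp: minimal_pi_dilation_def)
  qed
  then show "pure n S \<longleftrightarrow> (\<forall>\<xi>. (\<lambda>d. \<Sum>\<^sub>\<infinity>w\<in>paths (stabilizing_graph J P n T) d.
      (norm (cadjoint (word_op T w) \<xi>))\<^sup>2) \<longlonglongrightarrow> 0)"
    unfolding T_iff S.pure_iff_vanishing by blast
qed

end
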